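(* If $S_1$, $S_2$ and $S$ are affine subsemigroups of an affine semigroup $T$ such that $S\subset S_1\cap S_2$ and $\mathrm{Grp}(S_1)\cap\mathrm{Grp}(S_2)=\mathrm{Grp}(S)$ in $\mathrm{Grp}(T)$, then $S_1\,\widetilde{\oplus}_S\,S_2\simeq S_1\oplus_S S_2\simeq S_1+S_2$, where $S_1+S_2$ is taken in $T$.
   Context: Monoids are commutative, written additively with identity $0$. An affine semigroup is a finitely generated, cancellative, torsion-free monoid (torsion free: $ns_1=ns_2$ for some positive integer $n$ implies $s_1=s_2$). An affine subsemigroup is a submonoid that is itself an affine semigroup. $\mathrm{Grp}(S)=\{s-t:s,t\in S\}$ is the group of differences. For homomorphisms $S\to S_1$, $S\to S_2$ of cancellative monoids (here the inclusions), $S_1\oplus_S S_2$ denotes the image of the composite $S_1\oplus S_2\to\mathrm{Grp}(S_1)\oplus\mathrm{Grp}(S_2)\to(\mathrm{Grp}(S_1)\oplus\mathrm{Grp}(S_2))/\{(s,-s):s\in\mathrm{Grp}(S)\}$. For affine semigroups, $S_1\,\widetilde{\oplus}_S\,S_2:=(S_1\oplus_S S_2)/\!\sim_{\mathrm{tor}}$, where $x\sim_{\mathrm{tor}}y$ iff $nx=ny$ for some positive integer $n$. *)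

theory Defs
  imports "HOL-Algebra.Coset"
begin

text \<open>
  Monoids are HOL-Algebra monoids, hence written multiplicatively: \<open>x \<otimes> y\<close> stands for
  \<open>x + y\<close>, \<open>\<one>\<close> for \<open>0\<close>, \<open>x [^] n\<close> for the multiple \<open>n x\<close>, and \<open>H <#> K\<close> for the sum of
  two subsets. A submonoid \<open>S\<close> of \<open>T\<close> is regarded as a monoid via \<open>T\<lparr>carrier := S\<rparr>\<close>.
\<close>

locale cancellative_monoid = comm_monoid M for M (structure) +
  assumes cancel:
    "\<lbrakk>x \<in> carrier M; y \<in> carrier M; z \<in> carrier M; x \<otimes> z = y \<otimes> z\<rbrakk> \<Longrightarrow> x = y"

locale affine_semigroup = cancellative_monoid M for M (structure) +
  assumes finitely_generated:
    "\<exists>A. finite A \<and> A \<subseteq> carrier M \<and> (\<Inter>{H. submonoid H M \<and> A \<subseteq> H}) = carrier M"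
  and torsion_free:
    "\<lbrakk>x \<in> carrier M; y \<in> carrier M; (n::nat) > 0; x [^] n = y [^] n\<rbrakk> \<Longrightarrow> x = y"

definition affine_subsemigroup :: "'a set \<Rightarrow> ('a, 'b) monoid_scheme \<Rightarrow> bool" where
  "affine_subsemigroup S T \<longleftrightarrow> submonoid S T \<and> affine_semigroup (T\<lparr>carrier := S\<rparr>)"

text \<open>The quotient of a monoid by a congruence relation on its carrier.\<close>

definition quot_monoid :: "('a, 'b) monoid_scheme \<Rightarrow> ('a \<times> 'a) set \<Rightarrow> 'a set monoid" where
  "quot_monoid M r =
     \<lparr>carrier = carrier M // r,
      mult = (\<lambda>A B. \<Union>a\<in>A. \<Union>b\<in>B. r `` {a \<otimes>\<^bsub>M\<^esub> b}),
      one = r `` {\<one>\<^bsub>M\<^esub>}\<rparr>"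

text \<open>
  The group of differences of a cancellative monoid: the class of \<open>(s, t)\<close> is the formal
  difference \<open>s - t\<close>. Without cancellativity \<open>diff_rel\<close> need not be transitive.
\<close>

definition diff_rel :: "('a, 'b) monoid_scheme \<Rightarrow> (('a \<times> 'a) \<times> ('a \<times> 'a)) set" where
  "diff_rel M = {((s, t), (s', t')). s \<in> carrier M \<and> t \<in> carrier M \<and>
     s' \<in> carrier M \<and> t' \<in> carrier M \<and> s \<otimes>\<^bsub>M\<^esub> t' = s' \<otimes>\<^bsub>M\<^esub> t}"

definition Grp :: "('a, 'b) monoid_scheme \<Rightarrow> ('a \<times> 'a) set monoid" where
  "Grp M = quot_monoid (M \<times>\<times> M) (diff_rel M)"

definition to_Grp :: "('a, 'b) monoid_scheme \<Rightarrow> 'a \<Rightarrow> ('a \<times> 'a) set" where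
  "to_Grp M s = diff_rel M `` {(s, \<one>\<^bsub>M\<^esub>)}"

text \<open>The homomorphism \<open>Grp M \<rightarrow> Grp N\<close> induced by a homomorphism \<open>f : M \<rightarrow> N\<close>.\<close>

definition Grp_map :: "('c, 'd) monoid_scheme \<Rightarrow> ('a \<Rightarrow> 'c) \<Rightarrow> ('a \<times> 'a) set \<Rightarrow> ('c \<times> 'c) set" where
  "Grp_map N f D = (\<Union>(s, t)\<in>D. diff_rel N `` {(f s, f t)})"

text \<open>For a submonoid \<open>S\<close> of \<open>T\<close>, the group \<open>Grp S\<close> as a subset of \<open>Grp T\<close>.\<close>

definition Grp_in :: "('a, 'b) monoid_scheme \<Rightarrow> 'a set \<Rightarrow> ('a \<times> 'a) set set" where
  "Grp_in T S = {to_Grp T s \<otimes>\<^bsub>Grp T\<^esub> inv\<^bsub>Grp T\<^esub> to_Grp T t | s t. s \<in> S \<and> t \<in> S}"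

text \<open>
  The amalgamated sum of \<open>S1\<close> and \<open>S2\<close> along homomorphisms \<open>f1 : S \<rightarrow> S1\<close>, \<open>f2 : S \<rightarrow> S2\<close> of
  cancellative monoids.
\<close>

definition antidiagonal ::
  "('s, 'r) monoid_scheme \<Rightarrow> ('a, 'b) monoid_scheme \<Rightarrow> ('c, 'd) monoid_scheme \<Rightarrow>
    ('s \<Rightarrow> 'a) \<Rightarrow> ('s \<Rightarrow> 'c) \<Rightarrow> (('a \<times> 'a) set \<times> ('c \<times> 'c) set) set" where
  "antidiagonal S S1 S2 f1 f2 =
     (\<lambda>g. (Grp_map S1 f1 g, inv\<^bsub>Grp S2\<^esub> Grp_map S2 f2 g)) ` carrier (Grp S)"

definition amalgam ::
  "('s, 'r) monoid_scheme \<Rightarrow> ('a, 'b) monoid_scheme \<Rightarrow> ('c, 'd) monoid_scheme \<Rightarrow>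
    ('s \<Rightarrow> 'a) \<Rightarrow> ('s \<Rightarrow> 'c) \<Rightarrow> (('a \<times> 'a) set \<times> ('c \<times> 'c) set) set monoid" where
  "amalgam S S1 S2 f1 f2 =
     (let G = Grp S1 \<times>\<times> Grp S2; K = antidiagonal S S1 S2 f1 f2
      in (G Mod K)\<lparr>carrier :=
           (\<lambda>(x, y). K #>\<^bsub>G\<^esub> (to_Grp S1 x, to_Grp S2 y)) ` (carrier S1 \<times> carrier S2)\<rparr>)"

definition tor_rel :: "('a, 'b) monoid_scheme \<Rightarrow> ('a \<times> 'a) set" where
  "tor_rel M = {(x, y). x \<in> carrier M \<and> y \<in> carrier M \<and>
     (\<exists>n::nat. n > 0 \<and> x [^]\<^bsub>M\<^esub> n = y [^]\<^bsub>M\<^esub> n)}"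

definition amalgam_tor ::
  "('s, 'r) monoid_scheme \<Rightarrow> ('a, 'b) monoid_scheme \<Rightarrow> ('c, 'd) monoid_scheme \<Rightarrow>
    ('s \<Rightarrow> 'a) \<Rightarrow> ('s \<Rightarrow> 'c) \<Rightarrow> (('a \<times> 'a) set \<times> ('c \<times> 'c) set) set set monoid" where
  "amalgam_tor S S1 S2 f1 f2 =
     quot_monoid (amalgam S S1 S2 f1 f2) (tor_rel (amalgam S S1 S2 f1 f2))"

end

theory Submission
  imports Defs
begin

text \<open>
  Write the monoids additively. Two pairs \<open>(x, y)\<close> and \<open>(x', y')\<close> in \<open>S1 \<times> S2\<close> have the same
  image in the amalgamated sum iff \<open>x - x'\<close> in \<open>Grp S1\<close> and \<open>y' - y\<close> in \<open>Grp S2\<close> come from one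
  and the same difference \<open>a - b\<close> of elements of \<open>S\<close> (lemma \<open>class_eq_iff\<close>). They have the same
  image in \<open>S1 + S2\<close> iff \<open>x + y = x' + y'\<close>, that is, \<open>x - x' = y' - y\<close> in \<open>Grp T\<close>. The former
  condition clearly implies the latter; conversely, the element \<open>x - x' = y' - y\<close> lies in
  \<open>Grp S1 \<inter> Grp S2\<close>, and the hypothesis that this intersection is \<open>Grp S\<close> provides \<open>a\<close> and \<open>b\<close>
  (lemma \<open>same_class_iff_same_product\<close>). So the amalgamated sum and \<open>S1 + S2\<close> are images of
  \<open>S1 \<times> S2\<close> under homomorphisms with the same kernel congruence, hence isomorphic
  (lemma \<open>iso_of_same_kernel\<close>).

  In particular the amalgamated sum embeds into the torsion-free monoid \<open>T\<close>, so it is itself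
  torsion free. Its torsion congruence is therefore equality, and dividing by it changes nothing
  (lemma \<open>quot_tor_rel_iso\<close>).
\<close>

section \<open>The group of differences\<close>

abbreviation diff_class :: "('a, 'b) monoid_scheme \<Rightarrow> 'a \<Rightarrow> 'a \<Rightarrow> ('a \<times> 'a) set" where
  "diff_class M s t \<equiv> diff_rel M `` {(s, t)}"

context cancellative_monoid
begin

text \<open>Cancellation enters through transitivity, where it removes the middle denominator.\<close>

lemma diff_rel_equiv: "equiv (carrier M \<times> carrier M) (diff_rel M)"
proof (rule equivI)
  show "diff_rel M \<subseteq> (carrier M \<times> carrier M) \<times> (carrier M \<times> carrier M)"
    by (auto simp: diff_rel_def)
  show "refl_on (carrier M \<times> carrier M) (diff_rel M)"
    by (auto simp: refl_on_def diff_rel_def)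
  show "sym (diff_rel M)"
    by (auto simp: sym_def diff_rel_def)
  show "trans (diff_rel M)"
  proof (rule transI, clarsimp simp: diff_rel_def)
    fix a b c d e f
    assume c: "a \<in> carrier M" "b \<in> carrier M" "c \<in> carrier M" "d \<in> carrier M"
      "e \<in> carrier M" "f \<in> carrier M"
      and ad: "a \<otimes> d = c \<otimes> b" and cf: "c \<otimes> f = e \<otimes> d"
    have "(a \<otimes> f) \<otimes> d = (a \<otimes> d) \<otimes> f" using c by (simp add: m_ac)
    also have "\<dots> = (c \<otimes> f) \<otimes> b" using c by (simp add: ad m_ac)
    also have "\<dots> = (e \<otimes> b) \<otimes> d" using c by (simp add: cf m_ac)
    finally show "a \<otimes> f = e \<otimes> b" using c cancel by blast
  qed
qed

lemma diff_class_eq_iff: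
  assumes "s \<in> carrier M" "t \<in> carrier M" "s' \<in> carrier M" "t' \<in> carrier M"
  shows "diff_class M s t = diff_class M s' t' \<longleftrightarrow> s \<otimes> t' = s' \<otimes> t"
  using assms by (subst eq_equiv_class_iff[OF diff_rel_equiv]) (auto simp: diff_rel_def)

lemma carrier_Grp: "carrier (Grp M) = {diff_class M s t | s t. s \<in> carrier M \<and> t \<in> carrier M}"
  by (auto simp: Grp_def quot_monoid_def quotient_def)

lemma diff_class_in_Grp:
  "s \<in> carrier M \<Longrightarrow> t \<in> carrier M \<Longrightarrow> diff_class M s t \<in> carrier (Grp M)"
  by (auto simp: carrier_Grp)

lemma one_Grp: "\<one>\<^bsub>Grp M\<^esub> = diff_class M \<one> \<one>"
  by (simp add: Grp_def quot_monoid_def)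

lemma mult_Grp:
  assumes "s \<in> carrier M" "t \<in> carrier M" "s' \<in> carrier M" "t' \<in> carrier M"
  shows "diff_class M s t \<otimes>\<^bsub>Grp M\<^esub> diff_class M s' t' = diff_class M (s \<otimes> s') (t \<otimes> t')"
proof -
  have "(\<lambda>p q. diff_rel M `` {p \<otimes>\<^bsub>M \<times>\<times> M\<^esub> q}) respects2 diff_rel M"
  proof (rule congruent2_commuteI[OF diff_rel_equiv])
    fix p q assume "p \<in> carrier M \<times> carrier M" "q \<in> carrier M \<times> carrier M"
    then show "diff_rel M `` {p \<otimes>\<^bsub>M \<times>\<times> M\<^esub> q} = diff_rel M `` {q \<otimes>\<^bsub>M \<times>\<times> M\<^esub> p}"
      by (auto simp: m_comm)
  next
    fix p q w assume w: "w \<in> carrier M \<times> carrier M" and pq: "(p, q) \<in> diff_rel M"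
    obtain a b c d e f where eq: "w = (a, b)" "p = (c, d)" "q = (e, f)"
      by (metis surj_pair)
    have cl: "a \<in> carrier M" "b \<in> carrier M" "c \<in> carrier M" "d \<in> carrier M"
        "e \<in> carrier M" "f \<in> carrier M" and cf: "c \<otimes> f = e \<otimes> d"
      using w pq eq by (auto simp: diff_rel_def)
    have "(a \<otimes> c) \<otimes> (b \<otimes> f) = (a \<otimes> b) \<otimes> (c \<otimes> f)" using cl by (simp add: m_ac)
    also have "\<dots> = (a \<otimes> e) \<otimes> (b \<otimes> d)" using cl by (simp add: cf m_ac)
    finally show "diff_rel M `` {w \<otimes>\<^bsub>M \<times>\<times> M\<^esub> p} = diff_rel M `` {w \<otimes>\<^bsub>M \<times>\<times> M\<^esub> q}"
      using cl by (simp add: eq diff_class_eq_iff)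
  qed
  from UN_equiv_class2[OF diff_rel_equiv diff_rel_equiv this, of "(s, t)" "(s', t')"]
  show ?thesis
    using assms by (simp add: Grp_def quot_monoid_def)
qed

lemma Grp_comm_group: "comm_group (Grp M)"
proof (rule comm_groupI)
  fix x y assume x: "x \<in> carrier (Grp M)" and y: "y \<in> carrier (Grp M)"
  then show "x \<otimes>\<^bsub>Grp M\<^esub> y \<in> carrier (Grp M)"
    by (auto simp: carrier_Grp mult_Grp) (metis m_closed)
  show "x \<otimes>\<^bsub>Grp M\<^esub> y = y \<otimes>\<^bsub>Grp M\<^esub> x"
    using x y by (auto simp: carrier_Grp mult_Grp m_comm)
  fix z assume "z \<in> carrier (Grp M)"
  with x y show "x \<otimes>\<^bsub>Grp M\<^esub> y \<otimes>\<^bsub>Grp M\<^esub> z = x \<otimes>\<^bsub>Grp M\<^esub> (y \<otimes>\<^bsub>Grp M\<^esub> z)"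
    by (auto simp: carrier_Grp mult_Grp m_assoc)
next
  fix x assume x: "x \<in> carrier (Grp M)"
  then show "\<one>\<^bsub>Grp M\<^esub> \<otimes>\<^bsub>Grp M\<^esub> x = x"
    by (auto simp: carrier_Grp one_Grp mult_Grp)
  from x obtain s t where st: "x = diff_class M s t" "s \<in> carrier M" "t \<in> carrier M"
    by (auto simp: carrier_Grp)
  then have "diff_class M t s \<otimes>\<^bsub>Grp M\<^esub> x = \<one>\<^bsub>Grp M\<^esub>"
    by (simp add: mult_Grp one_Grp diff_class_eq_iff m_comm)
  with st show "\<exists>y\<in>carrier (Grp M). y \<otimes>\<^bsub>Grp M\<^esub> x = \<one>\<^bsub>Grp M\<^esub>"
    using diff_class_in_Grp by blast
qed (simp add: one_Grp diff_class_in_Grp)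

lemma inv_Grp:
  assumes "s \<in> carrier M" "t \<in> carrier M"
  shows "inv\<^bsub>Grp M\<^esub> diff_class M s t = diff_class M t s"
proof -
  interpret G: comm_group "Grp M" by (rule Grp_comm_group)
  show ?thesis
    using assms by (intro G.inv_equality)
      (simp_all add: mult_Grp one_Grp diff_class_eq_iff m_comm diff_class_in_Grp)
qed

lemma to_Grp_in_Grp: "s \<in> carrier M \<Longrightarrow> to_Grp M s \<in> carrier (Grp M)"
  by (simp add: to_Grp_def diff_class_in_Grp)

lemma to_Grp_mult:
  "s \<in> carrier M \<Longrightarrow> t \<in> carrier M \<Longrightarrow> to_Grp M (s \<otimes> t) = to_Grp M s \<otimes>\<^bsub>Grp M\<^esub> to_Grp M t"
  by (simp add: to_Grp_def mult_Grp)

lemma to_Grp_diff: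
  "s \<in> carrier M \<Longrightarrow> t \<in> carrier M \<Longrightarrow>
    to_Grp M s \<otimes>\<^bsub>Grp M\<^esub> inv\<^bsub>Grp M\<^esub> to_Grp M t = diff_class M s t"
  by (simp add: to_Grp_def mult_Grp inv_Grp)

lemma Grp_in_eq:
  assumes "S \<subseteq> carrier M"
  shows "Grp_in M S = {diff_class M s t | s t. s \<in> S \<and> t \<in> S}"
proof -
  have "to_Grp M s \<otimes>\<^bsub>Grp M\<^esub> inv\<^bsub>Grp M\<^esub> to_Grp M t = diff_class M s t" if "s \<in> S" "t \<in> S" for s t
    using that assms to_Grp_diff by blast
  then show ?thesis
    unfolding Grp_in_def by (intro Collect_cong) metis
qed

lemma Grp_map_diff_class:
  assumes "cancellative_monoid N" "f \<in> hom M N" "s \<in> carrier M" "t \<in> carrier M"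
  shows "Grp_map N f (diff_class M s t) = diff_class N (f s) (f t)"
proof -
  interpret N: cancellative_monoid N by fact
  have f: "f x \<in> carrier N" if "x \<in> carrier M" for x
    using assms(2) that by (auto simp: hom_def)
  have "(\<lambda>(s, t). diff_class N (f s) (f t)) respects diff_rel M"
  proof (rule congruentI, clarify)
    fix s t s' t' assume "((s, t), (s', t')) \<in> diff_rel M"
    then have c: "s \<in> carrier M" "t \<in> carrier M" "s' \<in> carrier M" "t' \<in> carrier M"
      and eq: "s \<otimes> t' = s' \<otimes> t"
      by (auto simp: diff_rel_def)
    from c have "f s \<otimes>\<^bsub>N\<^esub> f t' = f s' \<otimes>\<^bsub>N\<^esub> f t"
      by (simp add: eq hom_mult[OF assms(2), symmetric])
    with c show "diff_class N (f s) (f t) = diff_class N (f s') (f t')"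
      by (simp add: N.diff_class_eq_iff f)
  qed
  from UN_equiv_class[OF diff_rel_equiv this, of "(s, t)"] assms(3,4) show ?thesis
    by (simp add: Grp_map_def)
qed

end

section \<open>The amalgamated sum\<close>

locale amalgam_data =
  S: cancellative_monoid S + S1: cancellative_monoid S1 + S2: cancellative_monoid S2
  for S :: "('s, 'r) monoid_scheme" and S1 :: "('a, 'b) monoid_scheme"
    and S2 :: "('c, 'd) monoid_scheme" +
  fixes f1 :: "'s \<Rightarrow> 'a" and f2 :: "'s \<Rightarrow> 'c"
  assumes f1_hom: "f1 \<in> hom S S1" and f2_hom: "f2 \<in> hom S S2"
begin

abbreviation "G \<equiv> Grp S1 \<times>\<times> Grp S2"
abbreviation "K \<equiv> antidiagonal S S1 S2 f1 f2"
abbreviation "A \<equiv> amalgam S S1 S2 f1 f2"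
abbreviation "cls \<equiv> \<lambda>(x, y). K #>\<^bsub>G\<^esub> (to_Grp S1 x, to_Grp S2 y)"

lemma f_closed [simp]:
  "a \<in> carrier S \<Longrightarrow> f1 a \<in> carrier S1" "a \<in> carrier S \<Longrightarrow> f2 a \<in> carrier S2"
  using f1_hom f2_hom by (auto simp: hom_def)

lemma G_comm_group: "comm_group G"
proof -
  interpret G1: comm_group "Grp S1" by (rule S1.Grp_comm_group)
  interpret G2: comm_group "Grp S2" by (rule S2.Grp_comm_group)
  show ?thesis
    by (rule group.group_comm_groupI[OF DirProd_group[OF G1.group_axioms G2.group_axioms]])
      (auto simp: G1.m_comm G2.m_comm)
qed

lemma antidiagonal_eq:
  "K = {(diff_class S1 (f1 a) (f1 b), diff_class S2 (f2 b) (f2 a)) | a b.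
          a \<in> carrier S \<and> b \<in> carrier S}"
proof -
  have "(Grp_map S1 f1 (diff_class S a b), inv\<^bsub>Grp S2\<^esub> Grp_map S2 f2 (diff_class S a b)) =
      (diff_class S1 (f1 a) (f1 b), diff_class S2 (f2 b) (f2 a))"
    if "a \<in> carrier S" "b \<in> carrier S" for a b
    using that f1_hom f2_hom
    by (simp add: S.Grp_map_diff_class S1.cancellative_monoid_axioms
        S2.cancellative_monoid_axioms S2.inv_Grp)
  note image = this
  show ?thesis
    unfolding antidiagonal_def S.carrier_Grp
  proof (intro equalityI subsetI; elim imageE CollectE exE conjE)
    fix p g a b
    assume "p = (Grp_map S1 f1 g, inv\<^bsub>Grp S2\<^esub> Grp_map S2 f2 g)"
      "g = diff_class S a b" "a \<in> carrier S" "b \<in> carrier S"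
    then show "p \<in> {(diff_class S1 (f1 a) (f1 b), diff_class S2 (f2 b) (f2 a)) | a b.
        a \<in> carrier S \<and> b \<in> carrier S}"
      using image by blast
  next
    fix p a b
    assume "p = (diff_class S1 (f1 a) (f1 b), diff_class S2 (f2 b) (f2 a))"
      "a \<in> carrier S" "b \<in> carrier S"
    then show "p \<in> (\<lambda>g. (Grp_map S1 f1 g, inv\<^bsub>Grp S2\<^esub> Grp_map S2 f2 g)) `
        {diff_class S s t | s t. s \<in> carrier S \<and> t \<in> carrier S}"
      using image[symmetric] by blast
  qed
qed

lemma antidiagonal_normal: "K \<lhd> G"
proof -
  interpret G: comm_group G by (rule G_comm_group)
  have "subgroup K G"
  proof (rule G.subgroupI)
    show "K \<subseteq> carrier G"
      by (auto simp: antidiagonal_eq simp del: Image_singleton_iff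
          intro!: S1.diff_class_in_Grp S2.diff_class_in_Grp)
    show "K \<noteq> {}"
      unfolding antidiagonal_eq using S.one_closed by blast
  next
    fix p assume "p \<in> K"
    then obtain a b where ab: "a \<in> carrier S" "b \<in> carrier S"
        "p = (diff_class S1 (f1 a) (f1 b), diff_class S2 (f2 b) (f2 a))"
      by (auto simp: antidiagonal_eq)
    then have "inv\<^bsub>G\<^esub> p = (diff_class S1 (f1 b) (f1 a), diff_class S2 (f2 a) (f2 b))"
      by (simp add: comm_group.axioms(2) S1.Grp_comm_group S2.Grp_comm_group
          S1.diff_class_in_Grp S2.diff_class_in_Grp S1.inv_Grp S2.inv_Grp)
    with ab show "inv\<^bsub>G\<^esub> p \<in> K" by (auto simp: antidiagonal_eq)
    fix q assume "q \<in> K"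
    then obtain c d where cd: "c \<in> carrier S" "d \<in> carrier S"
        "q = (diff_class S1 (f1 c) (f1 d), diff_class S2 (f2 d) (f2 c))"
      by (auto simp: antidiagonal_eq)
    with ab have "p \<otimes>\<^bsub>G\<^esub> q = (diff_class S1 (f1 (a \<otimes>\<^bsub>S\<^esub> c)) (f1 (b \<otimes>\<^bsub>S\<^esub> d)),
        diff_class S2 (f2 (b \<otimes>\<^bsub>S\<^esub> d)) (f2 (a \<otimes>\<^bsub>S\<^esub> c)))"
      by (simp add: S1.mult_Grp S2.mult_Grp hom_mult[OF f1_hom] hom_mult[OF f2_hom])
    moreover have "a \<otimes>\<^bsub>S\<^esub> c \<in> carrier S" "b \<otimes>\<^bsub>S\<^esub> d \<in> carrier S"
      using ab cd by auto
    ultimately show "p \<otimes>\<^bsub>G\<^esub> q \<in> K" unfolding antidiagonal_eq by blast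
  qed
  then show ?thesis by (rule G.subgroup_imp_normal)
qed

text \<open>
  The antidiagonal consists of the pairs \<open>(a - b, b - a)\<close> with \<open>a\<close>, \<open>b\<close> in \<open>S\<close>. Clearing
  denominators expresses membership of a difference of two pairs by equations in \<open>S1\<close> and \<open>S2\<close>.
\<close>

lemma class_eq_iff:
  assumes "x \<in> carrier S1" "y \<in> carrier S2" "x' \<in> carrier S1" "y' \<in> carrier S2"
  shows "cls (x, y) = cls (x', y') \<longleftrightarrow>
    (\<exists>a\<in>carrier S. \<exists>b\<in>carrier S.
      x \<otimes>\<^bsub>S1\<^esub> f1 b = f1 a \<otimes>\<^bsub>S1\<^esub> x' \<and> y \<otimes>\<^bsub>S2\<^esub> f2 a = f2 b \<otimes>\<^bsub>S2\<^esub> y')"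
proof -
  interpret G: comm_group G by (rule G_comm_group)
  interpret K: normal K G by (rule antidiagonal_normal)
  let ?p = "(to_Grp S1 x, to_Grp S2 y)" and ?p' = "(to_Grp S1 x', to_Grp S2 y')"
  have c: "?p \<in> carrier G" "?p' \<in> carrier G"
    using assms by (simp_all add: S1.to_Grp_in_Grp S2.to_Grp_in_Grp)
  have "cls (x, y) = cls (x', y') \<longleftrightarrow> ?p \<in> K #>\<^bsub>G\<^esub> ?p'"
    using c G.repr_independence[OF _ _ K.subgroup_axioms]
      G.repr_independenceD[OF K.subgroup_axioms] by (metis case_prod_conv)
  also have "\<dots> \<longleftrightarrow> ?p \<otimes>\<^bsub>G\<^esub> inv\<^bsub>G\<^esub> ?p' \<in> K"
    using c by (intro K.rcos_module) auto
  also have "?p \<otimes>\<^bsub>G\<^esub> inv\<^bsub>G\<^esub> ?p' = (diff_class S1 x x', diff_class S2 y y')"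
    using assms
    by (simp add: comm_group.axioms(2) S1.Grp_comm_group S2.Grp_comm_group
        S1.to_Grp_in_Grp S2.to_Grp_in_Grp S1.to_Grp_diff S2.to_Grp_diff)
  also have "\<dots> \<in> K \<longleftrightarrow> (\<exists>a\<in>carrier S. \<exists>b\<in>carrier S.
      diff_class S1 x x' = diff_class S1 (f1 a) (f1 b) \<and>
      diff_class S2 y y' = diff_class S2 (f2 b) (f2 a))"
    unfolding antidiagonal_eq by blast
  also have "\<dots> \<longleftrightarrow> (\<exists>a\<in>carrier S. \<exists>b\<in>carrier S.
      x \<otimes>\<^bsub>S1\<^esub> f1 b = f1 a \<otimes>\<^bsub>S1\<^esub> x' \<and> y \<otimes>\<^bsub>S2\<^esub> f2 a = f2 b \<otimes>\<^bsub>S2\<^esub> y')"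
    using assms by (simp add: S1.diff_class_eq_iff S2.diff_class_eq_iff del: Image_singleton_iff)
  finally show ?thesis .
qed

lemma carrier_amalgam: "carrier A = cls ` carrier (S1 \<times>\<times> S2)"
  by (simp add: amalgam_def Let_def)

lemma class_mult:
  assumes "p \<in> carrier (S1 \<times>\<times> S2)" "q \<in> carrier (S1 \<times>\<times> S2)"
  shows "cls (p \<otimes>\<^bsub>S1 \<times>\<times> S2\<^esub> q) = cls p \<otimes>\<^bsub>A\<^esub> cls q"
proof -
  interpret K: normal K G by (rule antidiagonal_normal)
  show ?thesis
    using assms
    by (auto simp: amalgam_def Let_def FactGroup_def K.rcos_sum S1.to_Grp_in_Grp
        S2.to_Grp_in_Grp S1.to_Grp_mult S2.to_Grp_mult)
qed

lemma class_one: "cls (\<one>\<^bsub>S1\<^esub>, \<one>\<^bsub>S2\<^esub>) = \<one>\<^bsub>A\<^esub>"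
proof -
  interpret G: comm_group G by (rule G_comm_group)
  interpret K: normal K G by (rule antidiagonal_normal)
  have "K #>\<^bsub>G\<^esub> \<one>\<^bsub>G\<^esub> = K"
    by (rule G.coset_join2[OF G.one_closed K.subgroup_axioms
          subgroup.one_closed[OF K.subgroup_axioms]])
  then show ?thesis
    by (simp add: amalgam_def Let_def FactGroup_def to_Grp_def S1.one_Grp S2.one_Grp)
qed

lemma class_hom: "cls \<in> hom (S1 \<times>\<times> S2) A"
  by (rule homI) (simp_all only: class_mult carrier_amalgam imageI)

lemma pairs_monoid: "monoid (S1 \<times>\<times> S2)"
  by (intro DirProd_monoid S1.monoid_axioms S2.monoid_axioms)

lemma amalgam_monoid: "monoid A"
proof -
  have "A\<lparr>carrier := cls ` carrier (S1 \<times>\<times> S2), one := cls \<one>\<^bsub>S1 \<times>\<times> S2\<^esub>\<rparr> = A"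
    unfolding one_DirProd class_one carrier_amalgam[symmetric] by simp
  with monoid.hom_imp_img_monoid[OF pairs_monoid class_hom] show ?thesis by simp
qed

end

section \<open>Isomorphisms\<close>

text \<open>
  Both images are quotients of \<open>P\<close> by the common kernel congruence. The isomorphism is returned
  together with its compatibility with \<open>f\<close> and \<open>g\<close>, which pins down its value at the unit.
\<close>

lemma iso_of_same_kernel:
  assumes f: "f \<in> hom P M" and g: "g \<in> hom P N" and P: "monoid P"
    and f_surj: "f ` carrier P = carrier M" and g_surj: "g ` carrier P = carrier N"
    and kernel: "\<And>p q. p \<in> carrier P \<Longrightarrow> q \<in> carrier P \<Longrightarrow> f p = f q \<longleftrightarrow> g p = g q"
  obtains h where "h \<in> iso M N" "\<And>p. p \<in> carrier P \<Longrightarrow> h (f p) = g p"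
proof
  interpret P: monoid P by fact
  let ?h = "\<lambda>x. g (inv_into (carrier P) f x)"
  show hf: "?h (f p) = g p" if "p \<in> carrier P" for p
    using that kernel by (meson f_inv_into_f imageI inv_into_into)
  have "?h \<in> hom M N"
  proof (rule homI)
    fix x assume "x \<in> carrier M"
    then obtain p where p: "p \<in> carrier P" "x = f p" using f_surj by auto
    with hf g_surj show "?h x \<in> carrier N" by auto
    fix y assume "y \<in> carrier M"
    then obtain q where q: "q \<in> carrier P" "y = f q" using f_surj by auto
    have "x \<otimes>\<^bsub>M\<^esub> y = f (p \<otimes>\<^bsub>P\<^esub> q)" using p q by (simp add: hom_mult[OF f])
    then show "?h (x \<otimes>\<^bsub>M\<^esub> y) = ?h x \<otimes>\<^bsub>N\<^esub> ?h y"
      using p q by (simp add: hf hom_mult[OF g])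
  qed
  moreover have "?h ` carrier M = carrier N"
    unfolding f_surj[symmetric] g_surj[symmetric] image_image using hf by (rule image_cong[OF refl])
  moreover have "inj_on ?h (carrier M)"
    unfolding f_surj[symmetric] by (rule inj_onI, elim imageE) (metis hf kernel)
  ultimately show "?h \<in> iso M N" by (simp add: iso_iff)
qed

lemma hom_nat_pow_monoid:
  assumes "monoid M" "h \<in> hom M N" "h \<one>\<^bsub>M\<^esub> = \<one>\<^bsub>N\<^esub>" "x \<in> carrier M"
  shows "h (x [^]\<^bsub>M\<^esub> (n::nat)) = h x [^]\<^bsub>N\<^esub> n"
proof (induction n)
  case 0
  then show ?case using assms by simp
next
  case (Suc n)
  interpret M: monoid M by fact
  show ?case using assms Suc by (simp add: hom_mult[OF assms(2)])
qed

text \<open>In the absence of torsion every class of \<open>tor_rel\<close> is a singleton.\<close>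

lemma quot_tor_rel_iso:
  assumes "monoid M"
    and torsion_free: "\<And>x y n. \<lbrakk>x \<in> carrier M; y \<in> carrier M; (n::nat) > 0;
      x [^]\<^bsub>M\<^esub> n = y [^]\<^bsub>M\<^esub> n\<rbrakk> \<Longrightarrow> x = y"
  shows "quot_monoid M (tor_rel M) \<cong> M"
proof (rule is_isoI)
  interpret M: monoid M by fact
  have cls: "tor_rel M `` {x} = {x}" if "x \<in> carrier M" for x
  proof (rule equalityI)
    show "tor_rel M `` {x} \<subseteq> {x}"
      using torsion_free unfolding tor_rel_def by blast
    have "(x, x) \<in> tor_rel M"
      using that zero_less_one unfolding tor_rel_def by blast
    then show "{x} \<subseteq> tor_rel M `` {x}" by simp
  qed
  have carr: "carrier (quot_monoid M (tor_rel M)) = (\<lambda>x. {x}) ` carrier M"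
    using cls by (auto simp: quot_monoid_def quotient_def)
  have "the_elem \<in> hom (quot_monoid M (tor_rel M)) M"
  proof (rule homI, unfold carr)
    fix A B
    assume "A \<in> (\<lambda>x. {x}) ` carrier M" "B \<in> (\<lambda>x. {x}) ` carrier M"
    then show "the_elem (A \<otimes>\<^bsub>quot_monoid M (tor_rel M)\<^esub> B) = the_elem A \<otimes>\<^bsub>M\<^esub> the_elem B"
      by (auto simp: quot_monoid_def cls simp del: Image_singleton_iff)
  qed auto
  then show "the_elem \<in> iso (quot_monoid M (tor_rel M)) M"
    by (auto simp: iso_iff carr inj_on_def image_image)
qed

section \<open>Submonoids of a common monoid\<close>

text \<open>
  From equality in the amalgamated sum one gets \<open>x + b = a + x'\<close> and \<open>y + a = b + y'\<close>; adding
  these and cancelling \<open>a + b\<close> gives \<open>x + y = x' + y'\<close>. Conversely \<open>x + y = x' + y'\<close> says that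
  \<open>x - x'\<close> and \<open>y' - y\<close> are the same element of \<open>Grp T\<close>; it lies in \<open>Grp S1\<close> and in \<open>Grp S2\<close>,
  hence in \<open>Grp S\<close>.
\<close>

lemma same_class_iff_same_product:
  assumes T: "cancellative_monoid T"
    and am: "amalgam_data (T\<lparr>carrier := S\<rparr>) (T\<lparr>carrier := S1\<rparr>) (T\<lparr>carrier := S2\<rparr>) (\<lambda>x. x) (\<lambda>x. x)"
    and sub: "S \<subseteq> carrier T" "S1 \<subseteq> carrier T" "S2 \<subseteq> carrier T"
    and Grp: "Grp_in T S1 \<inter> Grp_in T S2 = Grp_in T S"
    and x: "x \<in> S1" "x' \<in> S1" and y: "y \<in> S2" "y' \<in> S2"
  defines "cls \<equiv>
    amalgam_data.cls (T\<lparr>carrier := S\<rparr>) (T\<lparr>carrier := S1\<rparr>) (T\<lparr>carrier := S2\<rparr>) (\<lambda>x. x) (\<lambda>x. x)"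
  shows "cls (x, y) = cls (x', y') \<longleftrightarrow> x \<otimes>\<^bsub>T\<^esub> y = x' \<otimes>\<^bsub>T\<^esub> y'"
proof -
  interpret T: cancellative_monoid T by fact
  interpret am: amalgam_data "T\<lparr>carrier := S\<rparr>" "T\<lparr>carrier := S1\<rparr>" "T\<lparr>carrier := S2\<rparr>"
    "\<lambda>x. x" "\<lambda>x. x" by fact
  have c: "x \<in> carrier T" "x' \<in> carrier T" "y \<in> carrier T" "y' \<in> carrier T"
    using x y sub by auto
  have "cls (x, y) = cls (x', y') \<longleftrightarrow>
      (\<exists>a\<in>S. \<exists>b\<in>S. x \<otimes>\<^bsub>T\<^esub> b = a \<otimes>\<^bsub>T\<^esub> x' \<and> y \<otimes>\<^bsub>T\<^esub> a = b \<otimes>\<^bsub>T\<^esub> y')"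
    unfolding cls_def using x y by (subst am.class_eq_iff) simp_all
  also have "\<dots> \<longleftrightarrow> x \<otimes>\<^bsub>T\<^esub> y = x' \<otimes>\<^bsub>T\<^esub> y'"
  proof safe
    fix a b
    assume "a \<in> S" "b \<in> S" and eq: "x \<otimes>\<^bsub>T\<^esub> b = a \<otimes>\<^bsub>T\<^esub> x'" "y \<otimes>\<^bsub>T\<^esub> a = b \<otimes>\<^bsub>T\<^esub> y'"
    then have ab: "a \<in> carrier T" "b \<in> carrier T" using sub by auto
    have "(x \<otimes>\<^bsub>T\<^esub> y) \<otimes>\<^bsub>T\<^esub> (a \<otimes>\<^bsub>T\<^esub> b) = (x \<otimes>\<^bsub>T\<^esub> b) \<otimes>\<^bsub>T\<^esub> (y \<otimes>\<^bsub>T\<^esub> a)"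
      using ab c by (simp add: T.m_ac)
    also have "\<dots> = (x' \<otimes>\<^bsub>T\<^esub> y') \<otimes>\<^bsub>T\<^esub> (a \<otimes>\<^bsub>T\<^esub> b)"
      unfolding eq using ab c by (simp add: T.m_ac)
    finally show "x \<otimes>\<^bsub>T\<^esub> y = x' \<otimes>\<^bsub>T\<^esub> y'"
      using ab c T.cancel[of _ _ "a \<otimes>\<^bsub>T\<^esub> b"] by blast
  next
    assume eq: "x \<otimes>\<^bsub>T\<^esub> y = x' \<otimes>\<^bsub>T\<^esub> y'"
    then have "diff_class T x x' = diff_class T y' y"
      using c by (simp add: T.diff_class_eq_iff T.m_comm)
    then have "diff_class T x x' \<in> Grp_in T S1 \<inter> Grp_in T S2"
      unfolding T.Grp_in_eq[OF sub(2)] T.Grp_in_eq[OF sub(3)] using x y by blast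
    then obtain a b where ab: "a \<in> S" "b \<in> S" "diff_class T x x' = diff_class T a b"
      unfolding Grp T.Grp_in_eq[OF sub(1)] by blast
    then have abT: "a \<in> carrier T" "b \<in> carrier T" using sub by auto
    have xb: "x \<otimes>\<^bsub>T\<^esub> b = a \<otimes>\<^bsub>T\<^esub> x'"
      using ab(3) abT c by (simp add: T.diff_class_eq_iff)
    have "diff_class T y' y = diff_class T a b"
      using ab(3) \<open>diff_class T x x' = diff_class T y' y\<close> by simp
    then have "y \<otimes>\<^bsub>T\<^esub> a = b \<otimes>\<^bsub>T\<^esub> y'"
      using abT c by (simp add: T.diff_class_eq_iff T.m_comm)
    with ab xb show "\<exists>a\<in>S. \<exists>b\<in>S. x \<otimes>\<^bsub>T\<^esub> b = a \<otimes>\<^bsub>T\<^esub> x' \<and> y \<otimes>\<^bsub>T\<^esub> a = b \<otimes>\<^bsub>T\<^esub> y'"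
      by blast
  qed
  finally show ?thesis .
qed

theorem corollary2p13:
  fixes T :: "('a, 'b) monoid_scheme" and S S1 S2 :: "'a set"
  assumes "affine_semigroup T"
    and "affine_subsemigroup S1 T" and "affine_subsemigroup S2 T" and "affine_subsemigroup S T"
    and "S \<subseteq> S1 \<inter> S2"
    and "Grp_in T S1 \<inter> Grp_in T S2 = Grp_in T S"
  shows "amalgam_tor (T\<lparr>carrier := S\<rparr>) (T\<lparr>carrier := S1\<rparr>) (T\<lparr>carrier := S2\<rparr>) (\<lambda>x. x) (\<lambda>x. x)
           \<cong> amalgam (T\<lparr>carrier := S\<rparr>) (T\<lparr>carrier := S1\<rparr>) (T\<lparr>carrier := S2\<rparr>) (\<lambda>x. x) (\<lambda>x. x)
       \<and> amalgam (T\<lparr>carrier := S\<rparr>) (T\<lparr>carrier := S1\<rparr>) (T\<lparr>carrier := S2\<rparr>) (\<lambda>x. x) (\<lambda>x. x)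
           \<cong> T\<lparr>carrier := S1 <#>\<^bsub>T\<^esub> S2\<rparr>"
proof -
  let ?S = "T\<lparr>carrier := S\<rparr>" and ?S1 = "T\<lparr>carrier := S1\<rparr>" and ?S2 = "T\<lparr>carrier := S2\<rparr>"
  let ?sum = "T\<lparr>carrier := S1 <#>\<^bsub>T\<^esub> S2\<rparr>"
  interpret T: affine_semigroup T by fact
  have sub: "S \<subseteq> carrier T" "S1 \<subseteq> carrier T" "S2 \<subseteq> carrier T"
    using assms by (auto simp: affine_subsemigroup_def dest: submonoid.subset)
  have canc: "cancellative_monoid ?S" "cancellative_monoid ?S1" "cancellative_monoid ?S2"
    using assms by (auto simp: affine_subsemigroup_def affine_semigroup_def)
  have am: "amalgam_data ?S ?S1 ?S2 (\<lambda>x. x) (\<lambda>x. x)"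
    using assms(5) by (intro amalgam_data.intro amalgam_data_axioms.intro canc) (auto simp: hom_def)
  interpret am: amalgam_data ?S ?S1 ?S2 "\<lambda>x. x" "\<lambda>x. x" by (rule am)
  define add where "add = (\<lambda>(x, y). x \<otimes>\<^bsub>T\<^esub> y)"
  have add_surj: "add ` carrier (?S1 \<times>\<times> ?S2) = carrier ?sum"
    by (auto simp: add_def set_mult_def)
  have add_hom: "add \<in> hom (?S1 \<times>\<times> ?S2) ?sum"
  proof (rule homI)
    fix p q assume "p \<in> carrier (?S1 \<times>\<times> ?S2)" "q \<in> carrier (?S1 \<times>\<times> ?S2)"
    then show "add (p \<otimes>\<^bsub>?S1 \<times>\<times> ?S2\<^esub> q) = add p \<otimes>\<^bsub>?sum\<^esub> add q"
      using sub by (auto simp: add_def T.m_ac subset_iff)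
  qed (use add_surj in blast)
  have kernel: "am.cls p = am.cls q \<longleftrightarrow> add p = add q"
    if "p \<in> carrier (?S1 \<times>\<times> ?S2)" "q \<in> carrier (?S1 \<times>\<times> ?S2)" for p q
  proof -
    obtain x y x' y' where p: "p = (x, y)" "q = (x', y')" by (metis surj_pair)
    with that have "x \<in> S1" "x' \<in> S1" "y \<in> S2" "y' \<in> S2" by auto
    from same_class_iff_same_product[OF T.cancellative_monoid_axioms am sub assms(6) this]
    show ?thesis unfolding p add_def case_prod_conv .
  qed
  obtain h where h: "h \<in> iso am.A ?sum"
      and h_cls: "\<And>p. p \<in> carrier (?S1 \<times>\<times> ?S2) \<Longrightarrow> h (am.cls p) = add p"
    using iso_of_same_kernel[OF am.class_hom add_hom am.pairs_monoid
        am.carrier_amalgam[symmetric] add_surj kernel] by blast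
  have "h (am.cls (\<one>\<^bsub>T\<^esub>, \<one>\<^bsub>T\<^esub>)) = \<one>\<^bsub>?sum\<^esub>"
    using am.S1.one_closed am.S2.one_closed by (subst h_cls) (auto simp: add_def)
  then have h_one: "h \<one>\<^bsub>am.A\<^esub> = \<one>\<^bsub>?sum\<^esub>"
    using am.class_one by simp
  have h_hom: "h \<in> hom am.A ?sum" and h_inj: "inj_on h (carrier am.A)"
    using h by (auto simp: iso_iff)
  have h_T: "h u \<in> carrier T" if "u \<in> carrier am.A" for u
  proof -
    have "h u \<in> carrier ?sum" using that hom_carrier[OF h_hom] by blast
    then obtain x y where "x \<in> S1" "y \<in> S2" "h u = x \<otimes>\<^bsub>T\<^esub> y"
      by (auto simp: set_mult_def)
    then show ?thesis using sub T.m_closed by (simp add: subset_iff)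
  qed
  \<comment> \<open>\<open>h\<close> embeds the amalgamated sum into \<open>T\<close> and preserves multiples, so torsion-freeness pulls back.\<close>
  have tf: "u = v" if "u \<in> carrier am.A" "v \<in> carrier am.A" "n > 0"
      "u [^]\<^bsub>am.A\<^esub> n = v [^]\<^bsub>am.A\<^esub> n" for u v and n :: nat
  proof -
    have "h u [^]\<^bsub>?sum\<^esub> n = h v [^]\<^bsub>?sum\<^esub> n"
      using that hom_nat_pow_monoid[OF am.amalgam_monoid h_hom h_one] by metis
    then have "h u [^]\<^bsub>T\<^esub> n = h v [^]\<^bsub>T\<^esub> n"
      by (simp add: T.nat_pow_consistent[symmetric])
    then have "h u = h v" using that h_T T.torsion_free by blast
    then show ?thesis using that h_inj by (auto dest: inj_onD)
  qed
  show ?thesis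
    using quot_tor_rel_iso[OF am.amalgam_monoid tf] is_isoI[OF h] by (simp add: amalgam_tor_def)
qed

end
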